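(* Let $K$ be a perfect field of characteristic $p>0$ and let $\mathcal D(A)=\bigcup_{i\ge0}\mathcal D(A)_i$ be the order filtration of $\mathcal D(A)$. Then, for each $i\ge0$, $\mathcal D(A)_i$ is a finitely generated left $A$-module.
   Context: Setting: $P_n=K[x_1,\dots,x_n]$ is a polynomial algebra; $I$ is a prime but not maximal ideal of $P_n$; $A=S^{-1}(P_n/I)$ is the localization of $P_n/I$ at a multiplicatively closed subset $S$, assumed to be a domain ($A$ is not assumed to be regular). Differential operators: $\mathcal D(A)=\bigcup_{i\ge0}\mathcal D(A)_i\subseteq\mathrm{End}_K(A)$ is the ring of $K$-linear differential operators on $A$, with $\mathcal D(A)_0=\mathrm{End}_A(A)\simeq A$ and $\mathcal D(A)_i=\{u\in\mathrm{End}_K(A): au-ua\in\mathcal D(A)_{i-1}\ \forall a\in A\}$. *)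

theory Defs
  imports
    "HOL-Library.Poly_Mapping"
    "HOL-Algebra.Module"
    "HOL-Algebra.QuotRing"
    "HOL-Algebra.Algebraic_Closure_Type"
begin

definition perfect_field :: "'k::field itself \<Rightarrow> bool" where
  "perfect_field _ \<longleftrightarrow> CHAR('k) = 0 \<or> surj (\<lambda>x::'k. x ^ CHAR('k))"

text \<open>
  The type below is the algebra \<open>P\<^sub>n = K[x\<^sub>1, \<dots>, x\<^sub>n]\<close>: the variables are the elements of the finite
  type \<open>'n\<close>, so \<open>n = CARD('n)\<close>, and a polynomial is a finitely supported map from exponent vectors
  to coefficients, multiplied by convolution. The case \<open>n = 0\<close>, which has no type \<open>'n\<close>, does not
  matter here: in a field every prime ideal is maximal.
\<close>

type_synonym ('n, 'k) mpoly = "('n \<Rightarrow>\<^sub>0 nat) \<Rightarrow>\<^sub>0 'k"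

abbreviation mpoly_ring :: "('n::finite, 'k::field) mpoly ring" where
  "mpoly_ring \<equiv> ring_of_type_algebra"

abbreviation mpoly_const :: "'k \<Rightarrow> ('n::finite, 'k::field) mpoly" where
  "mpoly_const c \<equiv> Poly_Mapping.single 0 c"


section \<open>Localization of a commutative ring at a multiplicative submonoid\<close>

definition loc_rel :: "('a, 'm) ring_scheme \<Rightarrow> 'a set \<Rightarrow> (('a \<times> 'a) \<times> ('a \<times> 'a)) set" where
  "loc_rel R S = {((a, s), (b, t)). a \<in> carrier R \<and> b \<in> carrier R \<and> s \<in> S \<and> t \<in> S \<and>
     (\<exists>u\<in>S. u \<otimes>\<^bsub>R\<^esub> (t \<otimes>\<^bsub>R\<^esub> a \<ominus>\<^bsub>R\<^esub> s \<otimes>\<^bsub>R\<^esub> b) = \<zero>\<^bsub>R\<^esub>)}"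

definition loc_frac :: "('a, 'm) ring_scheme \<Rightarrow> 'a set \<Rightarrow> 'a \<Rightarrow> 'a \<Rightarrow> ('a \<times> 'a) set" where
  "loc_frac R S a s = loc_rel R S `` {(a, s)}"

text \<open>In the operations below all members of each union are the same class.\<close>

definition localization :: "('a, 'm) ring_scheme \<Rightarrow> 'a set \<Rightarrow> ('a \<times> 'a) set ring" where
  "localization R S =
    \<lparr>carrier = (carrier R \<times> S) // loc_rel R S,
     monoid.mult = (\<lambda>x y. \<Union>(a, s)\<in>x. \<Union>(b, t)\<in>y. loc_frac R S (a \<otimes>\<^bsub>R\<^esub> b) (s \<otimes>\<^bsub>R\<^esub> t)),
     one = loc_frac R S \<one>\<^bsub>R\<^esub> \<one>\<^bsub>R\<^esub>,
     ring.zero = loc_frac R S \<zero>\<^bsub>R\<^esub> \<one>\<^bsub>R\<^esub>,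
     add = (\<lambda>x y. \<Union>(a, s)\<in>x. \<Union>(b, t)\<in>y.
              loc_frac R S (t \<otimes>\<^bsub>R\<^esub> a \<oplus>\<^bsub>R\<^esub> s \<otimes>\<^bsub>R\<^esub> b) (s \<otimes>\<^bsub>R\<^esub> t))\<rparr>"

text \<open>\<open>S\<inverse>(P\<^sub>n/I)\<close> as a \<open>K\<close>-algebra: a scalar \<open>c\<close> acts as multiplication by \<open>(c + I)/1\<close>.\<close>

definition loc_algebra ::
  "('n::finite, 'k::field) mpoly set \<Rightarrow> ('n, 'k) mpoly set set \<Rightarrow>
   ('k, (('n, 'k) mpoly set \<times> ('n, 'k) mpoly set) set) module" where
  "loc_algebra I S = (let Q = mpoly_ring Quot I; L = localization Q S in
    ring.extend L (module.fields
      (\<lambda>c x. loc_frac Q S (I +>\<^bsub>mpoly_ring\<^esub> mpoly_const c) \<one>\<^bsub>Q\<^esub> \<otimes>\<^bsub>L\<^esub> x)))"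


section \<open>Differential operators\<close>

text \<open>
  Endomorphisms are taken to be \<open>undefined\<close> outside the carrier, so that equality of functions
  is equality on the carrier.
\<close>

definition module_endo :: "('r, 'm) ring_scheme \<Rightarrow> ('r, 'a, 'q) module_scheme \<Rightarrow> ('a \<Rightarrow> 'a) set" where
  "module_endo R M = {u \<in> carrier M \<rightarrow>\<^sub>E carrier M.
     (\<forall>x\<in>carrier M. \<forall>y\<in>carrier M. u (x \<oplus>\<^bsub>M\<^esub> y) = u x \<oplus>\<^bsub>M\<^esub> u y) \<and>
     (\<forall>c\<in>carrier R. \<forall>x\<in>carrier M. u (c \<odot>\<^bsub>M\<^esub> x) = c \<odot>\<^bsub>M\<^esub> u x)}"

definition regular_module :: "('a, 'm) ring_scheme \<Rightarrow> ('a, 'a) module" where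
  "regular_module A = ring.extend (ring.truncate A) (module.fields (monoid.mult A))"

text \<open>\<open>\<D>(A)\<^sub>i\<close>, for a commutative \<open>K\<close>-algebra \<open>A\<close>:\<close>

primrec diff_ops_le ::
  "('k, 'm) ring_scheme \<Rightarrow> ('k, 'a, 'q) module_scheme \<Rightarrow> nat \<Rightarrow> ('a \<Rightarrow> 'a) set" where
  "diff_ops_le K A 0 = module_endo A (regular_module A)"
| "diff_ops_le K A (Suc i) = {u \<in> module_endo K A.
     \<forall>a\<in>carrier A. (\<lambda>x\<in>carrier A. a \<otimes>\<^bsub>A\<^esub> u x \<ominus>\<^bsub>A\<^esub> u (a \<otimes>\<^bsub>A\<^esub> x)) \<in> diff_ops_le K A i}"

text \<open>\<open>\<D>(A)\<close>, a ring under composition, with its left \<open>A\<close>-module structure \<open>(a u)(x) = a u(x)\<close>:\<close>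

definition diff_op_module ::
  "('k, 'm) ring_scheme \<Rightarrow> ('k, 'a, 'q) module_scheme \<Rightarrow> ('a, 'a \<Rightarrow> 'a) module" where
  "diff_op_module K A =
    \<lparr>carrier = (\<Union>i. diff_ops_le K A i),
     monoid.mult = compose (carrier A),
     one = (\<lambda>x\<in>carrier A. x),
     ring.zero = (\<lambda>x\<in>carrier A. \<zero>\<^bsub>A\<^esub>),
     add = (\<lambda>u v. \<lambda>x\<in>carrier A. u x \<oplus>\<^bsub>A\<^esub> v x),
     module.smult = (\<lambda>a u. \<lambda>x\<in>carrier A. a \<otimes>\<^bsub>A\<^esub> u x)\<rparr>"

definition finitely_generated_module ::
  "('a, 'm) ring_scheme \<Rightarrow> ('a, 'b, 'q) module_scheme \<Rightarrow> bool" where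
  "finitely_generated_module R M \<longleftrightarrow> module R M \<and>
     (\<exists>F. finite F \<and> F \<subseteq> carrier M \<and>
       (\<forall>m\<in>carrier M. \<exists>c\<in>F \<rightarrow> carrier R. m = (\<Oplus>\<^bsub>M\<^esub>f\<in>F. c f \<odot>\<^bsub>M\<^esub> f)))"

end

theory Submission
  imports Defs "HOL-Library.Function_Algebras"
begin

text \<open>
  A differential operator of order at most \<open>i\<close> is determined by its values at the finitely many
  monomials of degree at most \<open>i\<close>: if it vanishes there, then its commutators with the variables
  vanish by induction, so it commutes with every polynomial, hence with every fraction, and it kills
  \<open>1\<close>. Thus \<open>\<D>(A)\<^sub>i\<close> embeds into a finite power \<open>A\<^sup>N\<close>. Pulling the image back to \<open>P\<^sub>n\<^sup>N\<close> gives a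
  finitely generated submodule by Hilbert's basis theorem, and clearing denominators shows that
  its generators also generate \<open>\<D>(A)\<^sub>i\<close> over \<open>A\<close>.
\<close>

section \<open>Hilbert's basis theorem\<close>

text \<open>Induction on the set of coordinates. If \<open>D\<close> works for \<open>J\<close> and
  \<open>N\<close> bounds the \<open>j\<close>-coordinates of \<open>D\<close>, then an element
  whose \<open>j\<close>-coordinate is at least \<open>N\<close> is still dominated through
  \<open>D\<close>. The remaining elements lie in the finitely many slices \<open>L' k\<close> with
  \<open>k < N\<close>, where coordinate \<open>j\<close> is constant and the induction hypothesis
  applies again.\<close>

lemma dickson_on_finite:
  fixes L :: "('n \<Rightarrow>\<^sub>0 nat) set"
  assumes "finite J"
  shows "\<exists>D. finite D \<and> D \<subseteq> L \<and> (\<forall>l\<in>L. \<exists>d\<in>D. \<forall>j\<in>J. Poly_Mapping.lookup d j \<le> Poly_Mapping.lookup l j)"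
  using assms
proof (induction J arbitrary: L rule: finite_induct)
  case empty
  show ?case
  proof (cases "L = {}")
    case False
    then obtain l where "l \<in> L" by blast
    then show ?thesis by (rule_tac x = "{l}" in exI) simp
  next
    case True
    then show ?thesis by (rule_tac x = "{}" in exI) simp
  qed
next
  case (insert j J)
  obtain D where D: "finite D" "D \<subseteq> L" "\<forall>l\<in>L. \<exists>d\<in>D. \<forall>j\<in>J. Poly_Mapping.lookup d j \<le> Poly_Mapping.lookup l j"
  proof -
    assume "\<And>D. finite D \<Longrightarrow> D \<subseteq> L \<Longrightarrow>
      \<forall>l\<in>L. \<exists>d\<in>D. \<forall>j\<in>J. Poly_Mapping.lookup d j \<le> Poly_Mapping.lookup l j \<Longrightarrow> ?thesis"
    with insert.IH[of L] show ?thesis by (elim exE conjE)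
  qed
  define L' where "L' k = {l\<in>L. Poly_Mapping.lookup l j = k}" for k
  have "\<exists>E. finite E \<and> E \<subseteq> L' k \<and>
      (\<forall>l\<in>L' k. \<exists>d\<in>E. \<forall>i\<in>J. Poly_Mapping.lookup d i \<le> Poly_Mapping.lookup l i)" for k
    by (rule insert.IH)
  then obtain E where E: "\<And>k. finite (E k)" "\<And>k. E k \<subseteq> L' k"
    "\<And>k. \<forall>l\<in>L' k. \<exists>d\<in>E k. \<forall>i\<in>J. Poly_Mapping.lookup d i \<le> Poly_Mapping.lookup l i"
    by metis
  \<comment> \<open>The sum is a crude upper bound that, unlike a maximum, also makes sense for
    empty \<open>D\<close>.\<close>
  define N where "N = (\<Sum>d\<in>D. Poly_Mapping.lookup d j)"
  have N: "Poly_Mapping.lookup d j \<le> N" if "d \<in> D" for d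
    unfolding N_def using D(1) that by (intro member_le_sum) auto
  define D' where "D' = D \<union> (\<Union>k<N. E k)"
  have "\<exists>d\<in>D'. \<forall>i\<in>insert j J. Poly_Mapping.lookup d i \<le> Poly_Mapping.lookup l i" if l: "l \<in> L" for l
  proof (cases "Poly_Mapping.lookup l j < N")
    case True
    obtain d where d: "d \<in> E (Poly_Mapping.lookup l j)" "\<forall>i\<in>J. Poly_Mapping.lookup d i \<le> Poly_Mapping.lookup l i"
      using E(3)[of "Poly_Mapping.lookup l j"] l unfolding L'_def by blast
    moreover have "Poly_Mapping.lookup d j = Poly_Mapping.lookup l j" using d(1) E(2) unfolding L'_def by blast
    ultimately show ?thesis using True unfolding D'_def
      by (intro bexI[of _ d]) auto
  next
    case False
    obtain d where d: "d \<in> D" "\<forall>i\<in>J. Poly_Mapping.lookup d i \<le> Poly_Mapping.lookup l i"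
      using D(3) l by blast
    with N[OF d(1)] False show ?thesis unfolding D'_def
      by (intro bexI[of _ d]) auto
  qed
  moreover have "finite D'" unfolding D'_def using D(1) E(1) by auto
  moreover have "D' \<subseteq> L" unfolding D'_def using D(2) E(2) unfolding L'_def by blast
  ultimately show ?case by blast
qed

lemma dickson:
  fixes L :: "('n::finite \<Rightarrow>\<^sub>0 nat) set"
  obtains D where "finite D" "D \<subseteq> L" "\<And>l. l \<in> L \<Longrightarrow> \<exists>d\<in>D. \<exists>m. l = m + d"
proof -
  obtain D where D: "finite D" "D \<subseteq> L" "\<forall>l\<in>L. \<exists>d\<in>D. \<forall>j\<in>UNIV. Poly_Mapping.lookup d j \<le> Poly_Mapping.lookup l j"
    using dickson_on_finite[of UNIV L] by auto
  have "\<exists>d\<in>D. \<exists>m. l = m + d" if l: "l \<in> L" for l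
  proof -
    obtain d where d: "d \<in> D" "\<forall>j. Poly_Mapping.lookup d j \<le> Poly_Mapping.lookup l j" using D(3) l by auto
    \<comment> \<open>Subtraction of exponents is truncated at zero; it is exact here because
      \<open>d\<close> is coordinatewise below \<open>l\<close>.\<close>
    have "l = (l - d) + d"
      by (rule poly_mapping_eqI) (simp add: d(2) lookup_add lookup_minus)
    with d(1) show ?thesis by blast
  qed
  with D(1,2) show thesis by (rule that)
qed

section \<open>A monomial order\<close>

lemma lex_map_add:
  fixes f g h :: "'n \<Rightarrow> nat"
  assumes "(map f xs, map g xs) \<in> lex less_than"
  shows "(map (\<lambda>j. h j + f j) xs, map (\<lambda>j. h j + g j) xs) \<in> lex less_than"
  using assms by (induction xs) auto

text \<open>Exponent vectors are listed along an enumeration of the variables and compared by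
  \<open>lenlex\<close>, which is both well-founded and total on lists. All keys have the same
  length, so this is the lexicographic order. The enumeration may repeat variables, since totality
  only requires that \<open>key\<close> be injective.\<close>

lemma monomial_order_exists:
  obtains r :: "('n::finite \<Rightarrow>\<^sub>0 nat) rel"
  where "wf r" "total r" "trans r" "\<And>a b c. (a, b) \<in> r \<Longrightarrow> (c + a, c + b) \<in> r"
proof -
  obtain xs :: "'n list" where xs: "set xs = UNIV" using finite_list[OF finite[of UNIV]] by metis
  define key where "key = (\<lambda>a :: 'n \<Rightarrow>\<^sub>0 nat. map (Poly_Mapping.lookup a) xs)"
  define r where "r = inv_image (lenlex less_than) key"
  have inj: "a = b" if "key a = key b" for a b
    using that xs unfolding key_def by (intro poly_mapping_eqI) (auto simp: map_eq_conv)
  show thesis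
  proof (rule that)
    show "wf r" unfolding r_def by (intro wf_inv_image wf_lenlex wf_less_than)
    show "trans r" unfolding r_def by (intro trans_inv_image lenlex_transI trans_less_than)
    show "total r"
      using total_lenlex[OF total_less_than] inj unfolding r_def total_on_def by auto
    show "(c + a, c + b) \<in> r" if "(a, b) \<in> r" for a b c
      using that lex_map_add[of "Poly_Mapping.lookup a" xs "Poly_Mapping.lookup b" "Poly_Mapping.lookup c"]
      by (auto simp: r_def key_def lenlex_def plus_poly_mapping.rep_eq)
  qed
qed

text \<open>Cancellation in the exponent monoid leaves a single term of the convolution. This
  computes the leading coefficient in the division step of \<open>hilbert_basis\<close>.\<close>

lemma lookup_single_mult:
  fixes g :: "'b::cancel_comm_monoid_add \<Rightarrow>\<^sub>0 'k::comm_ring_1"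
  shows "Poly_Mapping.lookup (Poly_Mapping.single m c * g) (m + k) = c * Poly_Mapping.lookup g k"
proof -
  have "Poly_Mapping.lookup (Poly_Mapping.single m c * g) (m + k)
      = Sum_any (\<lambda>l. (c * Sum_any (\<lambda>q. Poly_Mapping.lookup g q when m + k = l + q)) when l = m)"
    unfolding lookup_mult by (intro Sum_any.cong) (auto simp: lookup_single when_def)
  also have "\<dots> = c * Sum_any (\<lambda>q. Poly_Mapping.lookup g q when k = q)"
    by simp
  finally show ?thesis by simp
qed

lemma finite_total_has_greatest:
  assumes "finite M" "M \<noteq> {}" "total r" "trans r"
  shows "\<exists>m\<in>M. \<forall>x\<in>M. x \<noteq> m \<longrightarrow> (x, m) \<in> r"
  using assms(1,2)
proof (induction M rule: finite_ne_induct)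
  case (insert y M)
  then obtain m where m: "m \<in> M" "\<And>x. x \<in> M \<Longrightarrow> x \<noteq> m \<Longrightarrow> (x, m) \<in> r" by blast
  show ?case
  proof (cases "(y, m) \<in> r")
    case True
    then show ?thesis using m by blast
  next
    case False
    then have "(m, y) \<in> r" using assms(3) m(1) insert.hyps unfolding total_on_def by (metis UNIV_I)
    then show ?thesis using m assms(4) by (metis insert_iff transD)
  qed
qed auto

section \<open>Finite generation of polynomial ideals\<close>

text \<open>For a commutative ring over itself, \<open>subspace\<close> means ideal and
  \<open>span\<close> means generated ideal.\<close>

interpretation ring_module: Modules.module "(*) :: 'r::comm_ring_1 \<Rightarrow> 'r \<Rightarrow> 'r"
  by standard (auto simp: algebra_simps)

text \<open>Dickson's lemma yields finitely many elements \<open>G\<close> whose leading monomials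
  divide those of all nonzero elements of \<open>I\<close>. An element of \<open>I\<close> outside
  the span of \<open>G\<close> with minimal leading monomial could be reduced by one division step
  to another such element with a smaller leading monomial.\<close>

theorem hilbert_basis:
  fixes I :: "('n::finite, 'k::field) mpoly set"
  assumes I: "ring_module.subspace I"
  obtains G where "finite G" "G \<subseteq> I" "I = ring_module.span G"
proof -
  obtain r :: "('n \<Rightarrow>\<^sub>0 nat) rel" where r: "wf r" "total r" "trans r"
    and r_add: "\<And>a b c. (a, b) \<in> r \<Longrightarrow> (c + a, c + b) \<in> r"
    using monomial_order_exists by blast
  define lm where "lm f = (SOME m. m \<in> Poly_Mapping.keys f \<and> (\<forall>x\<in>Poly_Mapping.keys f. x \<noteq> m \<longrightarrow> (x, m) \<in> r))"
    for f :: "('n, 'k) mpoly"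
  have lm: "lm f \<in> Poly_Mapping.keys f" "\<And>x. x \<in> Poly_Mapping.keys f \<Longrightarrow> x \<noteq> lm f \<Longrightarrow> (x, lm f) \<in> r" if "f \<noteq> 0" for f
    using someI_ex[OF finite_total_has_greatest[OF finite_keys[of f] _ r(2,3), unfolded Bex_def]] that
    unfolding lm_def by auto
  obtain D where D: "finite D" "D \<subseteq> lm ` (I - {0})"
    "\<And>l. l \<in> lm ` (I - {0}) \<Longrightarrow> \<exists>d\<in>D. \<exists>m. l = m + d"
    using dickson[of "lm ` (I - {0})"] by blast
  obtain G where G: "G \<subseteq> I - {0}" "finite G" "D = lm ` G"
    using finite_subset_image[OF D(1,2)] by blast
  have span_sub: "ring_module.span G \<subseteq> I"
    using G(1) I by (intro ring_module.span_minimal) auto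
  have "I \<subseteq> ring_module.span G"
  proof (rule ccontr)
    assume "\<not> I \<subseteq> ring_module.span G"
    then have "lm ` (I - ring_module.span G) \<noteq> {}" by blast
    then obtain z where z: "z \<in> lm ` (I - ring_module.span G)"
      "\<And>y. (y, z) \<in> r \<Longrightarrow> y \<notin> lm ` (I - ring_module.span G)"
      using wfE_min'[OF r(1)] by metis
    obtain f where f: "f \<in> I" "f \<notin> ring_module.span G" "z = lm f" using z(1) by blast
    have f0: "f \<noteq> 0" using f(2) by (auto simp: ring_module.span_zero)
    obtain g m where g: "g \<in> G" and m: "lm f = m + lm g"
      using D(3)[of "lm f"] f(1) f0 G(3) by blast
    have g0: "g \<noteq> 0" using g G(1) by blast
    \<comment> \<open>This multiple of \<open>g\<close> has the same leading term as
      \<open>f\<close>, so subtracting it cancels that term.\<close>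
    define h where "h = Poly_Mapping.single m (Poly_Mapping.lookup f (lm f) / Poly_Mapping.lookup g (lm g)) * g"
    have h: "h \<in> ring_module.span G"
      unfolding h_def using g by (intro ring_module.span_scale ring_module.span_base)
    have "f - h \<in> I"
      using h span_sub f(1) I by (blast intro: ring_module.subspace_diff)
    moreover have "f - h \<notin> ring_module.span G"
      using ring_module.span_add[OF _ h, of "f - h"] f(2) by auto
    ultimately have d: "f - h \<in> I" "f - h \<notin> ring_module.span G" by blast+
    have "f - h \<noteq> 0" using d(2) by (auto simp: ring_module.span_zero)
    have "Poly_Mapping.lookup h (lm f) = Poly_Mapping.lookup f (lm f)"
      unfolding h_def m lookup_single_mult using lm(1)[OF g0] by (simp add: in_keys_iff)
    then have ne: "lm (f - h) \<noteq> lm f"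
      using lm(1)[OF \<open>f - h \<noteq> 0\<close>] by (auto simp: in_keys_iff lookup_minus)
    have "lm (f - h) \<in> Poly_Mapping.keys f \<union> Poly_Mapping.keys h"
      using lm(1)[OF \<open>f - h \<noteq> 0\<close>] by (auto simp: in_keys_iff lookup_minus)
    \<comment> \<open>Every monomial of \<open>h\<close> is a shift by \<open>m\<close> of one of
      \<open>g\<close>. Translation invariance of \<open>r\<close> therefore bounds it by
      \<open>m + lm g = lm f\<close>.\<close>
    moreover have "Poly_Mapping.keys h \<subseteq> (+) m ` Poly_Mapping.keys g"
      unfolding h_def by (rule order_trans[OF keys_mult]) (auto split: if_splits)
    ultimately consider "lm (f - h) \<in> Poly_Mapping.keys f"
      | x where "x \<in> Poly_Mapping.keys g" "lm (f - h) = m + x" by blast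
    then have "(lm (f - h), lm f) \<in> r"
    proof cases
      case 1
      then show ?thesis using lm(2)[OF f0] ne by blast
    next
      case 2
      then have "x \<noteq> lm g" using ne m by auto
      then show ?thesis using lm(2)[OF g0 2(1)] r_add 2(2) m by simp
    qed
    then show False using z(2) f(3) d by blast
  qed
  then have "I = ring_module.span G" using span_sub by (rule equalityI)
  moreover have "G \<subseteq> I" using G(1) by blast
  ultimately show thesis using G(2) by (intro that)
qed

section \<open>Submodules of finite powers of the polynomial algebra\<close>

lemma module_fun: "Modules.module (\<lambda>(a::'r::comm_ring_1) (v :: 'j \<Rightarrow> 'r) j. a * v j)"
proof
  fix a b :: 'r and v w :: "'j \<Rightarrow> 'r"
  show "(\<lambda>j. a * (v + w) j) = (\<lambda>j. a * v j) + (\<lambda>j. a * w j)"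
    by (rule ext, subst plus_fun_apply, subst plus_fun_apply, rule distrib_left)
  show "(\<lambda>j. (a + b) * v j) = (\<lambda>j. a * v j) + (\<lambda>j. b * v j)"
    by (rule ext, subst plus_fun_apply, rule distrib_right)
  show "(\<lambda>j. a * (b * v j)) = (\<lambda>j. (a * b) * v j)"
    by (rule ext, rule mult.assoc[symmetric])
  show "(\<lambda>j. 1 * v j) = v"
    by (rule ext, rule mult_1_left)
qed

interpretation fun_module: Modules.module "\<lambda>(a::'r::comm_ring_1) (v :: 'j \<Rightarrow> 'r) j. a * v j"
  by (rule module_fun)

text \<open>Induction on the support \<open>J\<close>, using the projection to coordinate
  \<open>j\<close>. Its image is an ideal, finitely generated by Hilbert's theorem; its kernel
  \<open>W0\<close> is supported on \<open>J\<close> and is finitely generated by induction.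
  Generators of the kernel together with lifts of generators of the image generate
  \<open>W\<close>.\<close>

lemma submodule_fun_finitely_generated:
  fixes W :: "('j \<Rightarrow> ('n::finite, 'k::field) mpoly) set"
  assumes "finite J" "fun_module.subspace W" "\<And>v j. v \<in> W \<Longrightarrow> j \<notin> J \<Longrightarrow> v j = 0"
  shows "\<exists>G. finite G \<and> W = fun_module.span G"
  using assms
proof (induction J arbitrary: W rule: finite_induct)
  case empty
  have "W = {0}" using empty.prems fun_module.subspace_0 by (fastforce simp: fun_eq_iff)
  then show ?case by (rule_tac x = "{}" in exI) simp
next
  case (insert j J)
  have "ring_module.subspace ((\<lambda>v. v j) ` W)"
  proof (rule ring_module.subspaceI)
    show "0 \<in> (\<lambda>v. v j) ` W"
      by (rule image_eqI[of _ _ 0]) (simp_all add: fun_module.subspace_0[OF insert.prems(1)])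
  next
    fix x y assume "x \<in> (\<lambda>v. v j) ` W" "y \<in> (\<lambda>v. v j) ` W"
    then obtain v w where "v \<in> W" "w \<in> W" "x = v j" "y = w j" by blast
    then show "x + y \<in> (\<lambda>v. v j) ` W"
      by (intro image_eqI[of _ _ "v + w"]) (simp_all add: fun_module.subspace_add[OF insert.prems(1)])
  next
    fix c x assume "x \<in> (\<lambda>v. v j) ` W"
    then obtain v where "v \<in> W" "x = v j" by blast
    then show "c * x \<in> (\<lambda>v. v j) ` W"
      by (intro image_eqI[of _ _ "\<lambda>i. c * v i"])
        (simp_all add: fun_module.subspace_scale[OF insert.prems(1)])
  qed
  then obtain H where H: "finite H" "H \<subseteq> (\<lambda>v. v j) ` W" "(\<lambda>v. v j) ` W = ring_module.span H"
    using hilbert_basis by blast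
  \<comment> \<open>\<open>G1\<close> consists of one preimage in \<open>W\<close> for each
    generator of the ideal of \<open>j\<close>-coordinates.\<close>
  obtain G1 where G1: "G1 \<subseteq> W" "finite G1" "H = (\<lambda>v. v j) ` G1"
    using finite_subset_image[OF H(1,2)] by blast
  define W0 where "W0 = {v\<in>W. v j = 0}"
  have W0: "fun_module.subspace W0"
    unfolding W0_def
    by (intro fun_module.subspaceI)
      (auto intro: fun_module.subspace_0 fun_module.subspace_add fun_module.subspace_scale insert.prems)
  have "v i = 0" if "v \<in> W0" "i \<notin> J" for v i
    using that insert.prems(2)[of v i] unfolding W0_def by (cases "i = j") simp_all
  with insert.IH[OF W0] obtain G0 where G0: "finite G0" "W0 = fun_module.span G0" by metis
  have "G0 \<subseteq> W" using fun_module.span_superset[of G0] G0(2) unfolding W0_def by blast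
  have sub: "fun_module.span (G0 \<union> G1) \<subseteq> W"
    using \<open>G0 \<subseteq> W\<close> G1(1) insert.prems(1) by (intro fun_module.span_minimal) auto
  have lift: "\<exists>w\<in>fun_module.span G1. w j = x" if "x \<in> ring_module.span H" for x
    using that
  proof (induction rule: ring_module.span_induct_alt)
    case base
    then show ?case by (intro bexI[of _ 0]) (auto intro: fun_module.span_zero)
  next
    case (step c x y)
    then obtain g w where "g \<in> G1" "x = g j" "w \<in> fun_module.span G1" "w j = y"
      using G1(3) by blast
    then show ?case
      using fun_module.span_add[OF fun_module.span_scale[OF fun_module.span_base]]
      by (intro bexI[of _ "(\<lambda>i. c * g i) + w"]) simp_all
  qed
  have "W \<subseteq> fun_module.span (G0 \<union> G1)"
  proof
    fix v assume v: "v \<in> W"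
    obtain w where w: "w \<in> fun_module.span G1" "w j = v j" using lift[of "v j"] H(3) v by blast
    have w': "w \<in> fun_module.span (G0 \<union> G1)" using w(1) fun_module.span_mono[of G1] by blast
    then have "w \<in> W" using sub by blast
    \<comment> \<open>Subtracting a combination of the lifts with the same
      \<open>j\<close>-coordinate lands in the kernel.\<close>
    then have "v - w \<in> W0"
      using v w(2) fun_module.subspace_diff[OF insert.prems(1)] unfolding W0_def by simp
    then have "v - w \<in> fun_module.span (G0 \<union> G1)"
      unfolding G0(2) using fun_module.span_mono[of G0] by blast
    then have "(v - w) + w \<in> fun_module.span (G0 \<union> G1)" using w' by (rule fun_module.span_add)
    then show "v \<in> fun_module.span (G0 \<union> G1)" by simp
  qed
  with sub G0(1) G1(2) show ?case by (metis finite_Un subset_antisym)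
qed

section \<open>Induction over polynomials\<close>

text \<open>Constants and variables generate the algebra: powers of variables give monomials, and
  monomials with constant coefficients give sums. The rule later extends commutation with the
  variables to all polynomials.\<close>

lemma mpoly_induct [case_names const var add mult]:
  fixes f :: "('n::finite, 'k::field) mpoly"
  assumes const: "\<And>c. P (mpoly_const c)"
    and var: "\<And>j. P (Poly_Mapping.single (Poly_Mapping.single j 1) 1)"
    and add: "\<And>f g. P f \<Longrightarrow> P g \<Longrightarrow> P (f + g)"
    and mult: "\<And>f g. P f \<Longrightarrow> P g \<Longrightarrow> P (f * g)"
  shows "P f"
proof -
  have power: "P (Poly_Mapping.single (Poly_Mapping.single j k) 1)" for j k
  proof (induction k)
    case 0
    show ?case using const[of 1] by simp
  next
    case (Suc k)
    have "Poly_Mapping.single j (Suc k) = Poly_Mapping.single j 1 + Poly_Mapping.single j k"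
      by (simp flip: single_add)
    then show ?case using mult[OF var[of j] Suc] by (simp add: mult_single)
  qed
  have monomial: "P (Poly_Mapping.single m 1)" for m
  proof (induction m rule: update_induct)
    case const
    show ?case using assms(1)[of 1] by simp
  next
    case (update m j k)
    \<comment> \<open>The induction only updates keys outside the support, so an update is an
      addition.\<close>
    have "Poly_Mapping.update j k m = Poly_Mapping.single j k + m"
      using update(1) by (intro poly_mapping_eqI) (auto simp: lookup_update lookup_add lookup_single in_keys_iff)
    then show ?case using mult[OF power[of j k] update(3)] by (simp add: mult_single)
  qed
  show ?thesis
  proof (induction f rule: update_induct)
    case const
    show ?case using assms(1)[of 0] by simp
  next
    case (update f m c)
    have "Poly_Mapping.update m c f = mpoly_const c * Poly_Mapping.single m 1 + f"
      using update(1)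
      by (intro poly_mapping_eqI) (auto simp: lookup_update lookup_add lookup_single in_keys_iff mult_single)
    then show ?case using add[OF mult[OF assms(1)[of c] monomial[of m]] update(3)] by simp
  qed
qed


section \<open>Localization\<close>

context cring
begin

text \<open>Trading the difference for an equation turns the checks below into rearrangements of
  products.\<close>

lemma loc_rel_iff:
  assumes "submonoid S R"
  shows "((a, s), (b, t)) \<in> loc_rel R S \<longleftrightarrow>
    a \<in> carrier R \<and> b \<in> carrier R \<and> s \<in> S \<and> t \<in> S \<and> (\<exists>u\<in>S. u \<otimes> (t \<otimes> a) = u \<otimes> (s \<otimes> b))"
proof -
  have S: "x \<in> carrier R" if "x \<in> S" for x using submonoid.subset[OF assms] that by blast
  have "u \<otimes> (x \<ominus> y) = \<zero> \<longleftrightarrow> u \<otimes> x = u \<otimes> y"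
    if "u \<in> carrier R" "x \<in> carrier R" "y \<in> carrier R" for u x y
  proof -
    have "u \<otimes> (x \<ominus> y) = u \<otimes> x \<ominus> u \<otimes> y" using that by (simp add: r_distr r_minus minus_eq)
    then show ?thesis using that by (simp add: r_right_minus_eq)
  qed
  then show ?thesis unfolding loc_rel_def by (auto simp: S)
qed

lemma equiv_loc_rel:
  assumes "submonoid S R"
  shows "equiv (carrier R \<times> S) (loc_rel R S)"
proof (rule equivI)
  note iff = loc_rel_iff[OF assms]
  have S: "x \<in> carrier R" if "x \<in> S" for x using submonoid.subset[OF assms] that by blast
  note [simp] = submonoid.m_closed[OF assms]
  show "loc_rel R S \<subseteq> (carrier R \<times> S) \<times> carrier R \<times> S" unfolding loc_rel_def by auto
  show "refl_on (carrier R \<times> S) (loc_rel R S)"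
    using submonoid.one_closed[OF assms] by (auto simp: refl_on_def iff S)
  show "sym (loc_rel R S)"
    by (rule symI) (clarsimp simp: iff, metis)
  show "trans (loc_rel R S)"
  proof (rule transI, clarsimp simp: iff)
    fix a s b t c r u v
    assume *: "a \<in> carrier R" "b \<in> carrier R" "c \<in> carrier R" "s \<in> S" "t \<in> S" "r \<in> S" "u \<in> S" "v \<in> S"
      and u: "u \<otimes> (t \<otimes> a) = u \<otimes> (s \<otimes> b)" and v: "v \<otimes> (r \<otimes> b) = v \<otimes> (t \<otimes> c)"
    \<comment> \<open>Multiplying the first relation by \<open>v r\<close> and the second by
      \<open>u s\<close> makes them meet at u v s r b. The outer terms then share the factor u v t,
      which is why the middle denominator \<open>t\<close> enters the witness.\<close>
    have "(u \<otimes> v \<otimes> t) \<otimes> (r \<otimes> a) = (v \<otimes> r) \<otimes> (u \<otimes> (t \<otimes> a))" using * by (simp add: S m_ac)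
    also have "\<dots> = (u \<otimes> s) \<otimes> (v \<otimes> (r \<otimes> b))" unfolding u using * by (simp add: S m_ac)
    also have "\<dots> = (u \<otimes> v \<otimes> t) \<otimes> (s \<otimes> c)" unfolding v using * by (simp add: S m_ac)
    finally show "\<exists>u\<in>S. u \<otimes> (r \<otimes> a) = u \<otimes> (s \<otimes> c)"
      using * by (intro bexI[of _ "u \<otimes> v \<otimes> t"]) simp_all
  qed
qed

lemma loc_frac_eq_iff:
  assumes "submonoid S R" "a \<in> carrier R" "b \<in> carrier R" "s \<in> S" "t \<in> S"
  shows "loc_frac R S a s = loc_frac R S b t \<longleftrightarrow> (\<exists>u\<in>S. u \<otimes> (t \<otimes> a) = u \<otimes> (s \<otimes> b))"
  unfolding loc_frac_def
  using assms eq_equiv_class_iff[OF equiv_loc_rel[OF assms(1)], of "(a, s)" "(b, t)"]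
  by (simp add: loc_rel_iff[OF assms(1)])

text \<open>The unions defining the product collapse to one class once independence of
  representatives is known; for this the two relations are multiplied, with witness
  \<open>u \<otimes> v\<close>.\<close>

lemma localization_mult:
  assumes S: "submonoid S R" and "a \<in> carrier R" "b \<in> carrier R" "s \<in> S" "t \<in> S"
  shows "loc_frac R S a s \<otimes>\<^bsub>localization R S\<^esub> loc_frac R S b t = loc_frac R S (a \<otimes> b) (s \<otimes> t)"
proof -
  have SR: "x \<in> carrier R" if "x \<in> S" for x using submonoid.subset[OF S] that by blast
  let ?f = "\<lambda>(a, s) (b, t). loc_frac R S (a \<otimes> b) (s \<otimes> t)"
  have "congruent2 (loc_rel R S) (loc_rel R S) ?f"
  proof (rule congruent2I', clarsimp simp: loc_rel_iff[OF S])
    fix a s a' s' b t b' t' u v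
    assume *: "a \<in> carrier R" "b \<in> carrier R" "s \<in> S" "t \<in> S" "u \<in> S"
      "a' \<in> carrier R" "b' \<in> carrier R" "s' \<in> S" "t' \<in> S" "v \<in> S"
      and u: "u \<otimes> (s' \<otimes> a) = u \<otimes> (s \<otimes> a')" and v: "v \<otimes> (t' \<otimes> b) = v \<otimes> (t \<otimes> b')"
    have "(u \<otimes> v) \<otimes> ((s' \<otimes> t') \<otimes> (a \<otimes> b)) = (u \<otimes> (s' \<otimes> a)) \<otimes> (v \<otimes> (t' \<otimes> b))"
      using * by (simp add: SR m_ac)
    also have "\<dots> = (u \<otimes> v) \<otimes> ((s \<otimes> t) \<otimes> (a' \<otimes> b'))"
      unfolding u v using * by (simp add: SR m_ac)
    finally show "loc_frac R S (a \<otimes> b) (s \<otimes> t) = loc_frac R S (a' \<otimes> b') (s' \<otimes> t')"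
      using * submonoid.m_closed[OF S] by (subst loc_frac_eq_iff[OF S]) auto
  qed
  then have "(\<Union>x\<in>loc_frac R S a s. \<Union>y\<in>loc_frac R S b t. ?f x y) = ?f (a, s) (b, t)"
    unfolding loc_frac_def[of R S a s] loc_frac_def[of R S b t]
    by (rule UN_equiv_class2[OF equiv_loc_rel[OF S] equiv_loc_rel[OF S]]) (use assms in auto)
  then show ?thesis unfolding localization_def by (simp add: case_prod_unfold)
qed

lemma localization_add:
  assumes S: "submonoid S R" and "a \<in> carrier R" "b \<in> carrier R" "s \<in> S" "t \<in> S"
  shows "loc_frac R S a s \<oplus>\<^bsub>localization R S\<^esub> loc_frac R S b t
    = loc_frac R S (t \<otimes> a \<oplus> s \<otimes> b) (s \<otimes> t)"
proof -
  have SR: "x \<in> carrier R" if "x \<in> S" for x using submonoid.subset[OF S] that by blast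
  let ?f = "\<lambda>(a, s) (b, t). loc_frac R S (t \<otimes> a \<oplus> s \<otimes> b) (s \<otimes> t)"
  have "congruent2 (loc_rel R S) (loc_rel R S) ?f"
  proof (rule congruent2I', clarsimp simp: loc_rel_iff[OF S])
    fix a s a' s' b t b' t' u v
    assume *: "a \<in> carrier R" "b \<in> carrier R" "s \<in> S" "t \<in> S" "u \<in> S"
      "a' \<in> carrier R" "b' \<in> carrier R" "s' \<in> S" "t' \<in> S" "v \<in> S"
      and u: "u \<otimes> (s' \<otimes> a) = u \<otimes> (s \<otimes> a')" and v: "v \<otimes> (t' \<otimes> b) = v \<otimes> (t \<otimes> b')"
    \<comment> \<open>Each summand is regrouped around the left side of one of the two relations, so
      that both can be rewritten separately.\<close>
    have "(u \<otimes> v) \<otimes> ((s' \<otimes> t') \<otimes> (t \<otimes> a \<oplus> s \<otimes> b))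
        = (v \<otimes> t \<otimes> t') \<otimes> (u \<otimes> (s' \<otimes> a)) \<oplus> (u \<otimes> s \<otimes> s') \<otimes> (v \<otimes> (t' \<otimes> b))"
      using * by (simp add: SR m_ac r_distr)
    also have "\<dots> = (u \<otimes> v) \<otimes> ((s \<otimes> t) \<otimes> (t' \<otimes> a' \<oplus> s' \<otimes> b'))"
      unfolding u v using * by (simp add: SR m_ac r_distr)
    finally show "loc_frac R S (t \<otimes> a \<oplus> s \<otimes> b) (s \<otimes> t) = loc_frac R S (t' \<otimes> a' \<oplus> s' \<otimes> b') (s' \<otimes> t')"
      using * submonoid.m_closed[OF S] by (subst loc_frac_eq_iff[OF S]) (auto simp: SR)
  qed
  then have "(\<Union>x\<in>loc_frac R S a s. \<Union>y\<in>loc_frac R S b t. ?f x y) = ?f (a, s) (b, t)"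
    unfolding loc_frac_def[of R S a s] loc_frac_def[of R S b t]
    by (rule UN_equiv_class2[OF equiv_loc_rel[OF S] equiv_loc_rel[OF S]]) (use assms in auto)
  then show ?thesis unfolding localization_def by (simp add: case_prod_unfold)
qed

lemma carrier_localization:
  "carrier (localization R S) = {loc_frac R S a s |a s. a \<in> carrier R \<and> s \<in> S}"
  unfolding localization_def loc_frac_def quotient_def by auto

lemma loc_frac_hom:
  assumes S: "submonoid S R"
  shows "(\<lambda>a. loc_frac R S a \<one>) \<in> ring_hom R (localization R S)"
proof -
  have "\<one>\<^bsub>localization R S\<^esub> = loc_frac R S \<one> \<one>" by (simp add: localization_def)
  then show ?thesis
    using submonoid.one_closed[OF S]
    by (intro ring_hom_memI)
      (auto simp: carrier_localization localization_mult[OF S] localization_add[OF S])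
qed

lemma loc_frac_self:
  assumes S: "submonoid S R" and "s \<in> S"
  shows "loc_frac R S s s = \<one>\<^bsub>localization R S\<^esub>"
proof -
  have "s \<in> carrier R" using submonoid.subset[OF S] assms(2) by blast
  moreover note submonoid.one_closed[OF S]
  ultimately have "loc_frac R S s s = loc_frac R S \<one> \<one>"
    using assms(2) by (subst loc_frac_eq_iff[OF S]) auto
  then show ?thesis by (simp add: localization_def)
qed

end


section \<open>Differential operators on localized quotients of polynomial algebras\<close>

context module
begin

text \<open>For finite \<open>F\<close> this is the generated submodule, in the form in which
  \<open>finitely_generated_module\<close> asks for coefficients.\<close>

definition combinations :: "'c set \<Rightarrow> 'c set" where
  "combinations F = {\<Oplus>\<^bsub>M\<^esub>f\<in>F. c f \<odot>\<^bsub>M\<^esub> f |c. c \<in> F \<rightarrow> carrier R}"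

lemma combinations_closed:
  assumes "F \<subseteq> carrier M"
  shows "combinations F \<subseteq> carrier M"
  using assms unfolding combinations_def by (auto intro!: M.finsum_closed)

lemma combinations_zero:
  assumes "F \<subseteq> carrier M"
  shows "\<zero>\<^bsub>M\<^esub> \<in> combinations F"
proof -
  have "(\<Oplus>\<^bsub>M\<^esub>f\<in>F. \<zero> \<odot>\<^bsub>M\<^esub> f) = (\<Oplus>\<^bsub>M\<^esub>f\<in>F. \<zero>\<^bsub>M\<^esub>)"
    using assms by (intro M.finsum_cong') auto
  then show ?thesis unfolding combinations_def by (auto simp: M.finsum_zero intro!: exI[of _ "\<lambda>_. \<zero>"])
qed

lemma combinations_add:
  assumes "F \<subseteq> carrier M" "x \<in> combinations F" "y \<in> combinations F"
  shows "x \<oplus>\<^bsub>M\<^esub> y \<in> combinations F"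
proof -
  obtain c d where c: "c \<in> F \<rightarrow> carrier R" "x = (\<Oplus>\<^bsub>M\<^esub>f\<in>F. c f \<odot>\<^bsub>M\<^esub> f)"
    and d: "d \<in> F \<rightarrow> carrier R" "y = (\<Oplus>\<^bsub>M\<^esub>f\<in>F. d f \<odot>\<^bsub>M\<^esub> f)"
    using assms(2,3) unfolding combinations_def by blast
  have "x \<oplus>\<^bsub>M\<^esub> y = (\<Oplus>\<^bsub>M\<^esub>f\<in>F. c f \<odot>\<^bsub>M\<^esub> f \<oplus>\<^bsub>M\<^esub> d f \<odot>\<^bsub>M\<^esub> f)"
    unfolding c(2) d(2) using c(1) d(1) assms(1) by (intro M.finsum_addf[symmetric]) auto
  also have "\<dots> = (\<Oplus>\<^bsub>M\<^esub>f\<in>F. (c f \<oplus> d f) \<odot>\<^bsub>M\<^esub> f)"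
    using c(1) d(1) assms(1) by (intro M.finsum_cong') (auto simp: smult_l_distr Pi_iff subset_iff)
  finally show ?thesis
    unfolding combinations_def using c(1) d(1) by (auto intro!: exI[of _ "\<lambda>f. c f \<oplus> d f"])
qed

lemma combinations_smult:
  assumes "finite F" "F \<subseteq> carrier M" "x \<in> combinations F" "a \<in> carrier R"
  shows "a \<odot>\<^bsub>M\<^esub> x \<in> combinations F"
proof -
  obtain c where c: "c \<in> F \<rightarrow> carrier R" "x = (\<Oplus>\<^bsub>M\<^esub>f\<in>F. c f \<odot>\<^bsub>M\<^esub> f)"
    using assms(3) unfolding combinations_def by blast
  have "a \<odot>\<^bsub>M\<^esub> x = (\<Oplus>\<^bsub>M\<^esub>f\<in>F. a \<odot>\<^bsub>M\<^esub> (c f \<odot>\<^bsub>M\<^esub> f))"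
    unfolding c(2) using c(1) assms by (intro finsum_smult_ldistr) auto
  also have "\<dots> = (\<Oplus>\<^bsub>M\<^esub>f\<in>F. (a \<otimes> c f) \<odot>\<^bsub>M\<^esub> f)"
    using c(1) assms(2,4) by (intro M.finsum_cong') (auto simp: smult_assoc1 Pi_iff subset_iff)
  finally show ?thesis
    unfolding combinations_def using c(1) assms(4) by (auto intro!: exI[of _ "\<lambda>f. a \<otimes> c f"])
qed

lemma combinations_base:
  assumes "finite F" "F \<subseteq> carrier M" "g \<in> F"
  shows "g \<in> combinations F"
proof -
  have "(\<Oplus>\<^bsub>M\<^esub>f\<in>F. (if g = f then \<one> else \<zero>) \<odot>\<^bsub>M\<^esub> f) = (\<Oplus>\<^bsub>M\<^esub>f\<in>F. if g = f then f else \<zero>\<^bsub>M\<^esub>)"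
    using assms by (intro M.finsum_cong') auto
  also have "\<dots> = g" using M.finsum_singleton[OF assms(3,1), of "\<lambda>f. f"] assms(2) by auto
  finally show ?thesis
    unfolding combinations_def by (auto intro!: exI[of _ "\<lambda>f. if g = f then \<one> else \<zero>"])
qed

end

section \<open>The order filtration as a chain of modules\<close>

text \<open>An abstraction of S^{-1}(P_n/I): \<open>\<phi>\<close> stands for the composite P_n ->
  P_n/I -> A, and \<open>denominator\<close> says that every element is a fraction of images of
  polynomials whose denominator is a unit.\<close>

locale localized_mpoly_algebra = cring A
  for A :: "('k::field, 'a, 'q) module_scheme" (structure) +
  fixes \<phi> :: "('n::finite, 'k) mpoly \<Rightarrow> 'a"
  assumes phi_closed [simp]: "\<phi> f \<in> carrier A"
    and phi_add: "\<phi> (f + g) = \<phi> f \<oplus> \<phi> g"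
    and phi_mult: "\<phi> (f * g) = \<phi> f \<otimes> \<phi> g"
    and phi_one: "\<phi> 1 = \<one>"
    and smult_eq: "x \<in> carrier A \<Longrightarrow> c \<odot> x = \<phi> (mpoly_const c) \<otimes> x"
    and denominator: "x \<in> carrier A \<Longrightarrow> \<exists>s f. \<phi> s \<in> Units A \<and> \<phi> s \<otimes> x = \<phi> f"
begin

abbreviation endo :: "('a \<Rightarrow> 'a) set" where
  "endo \<equiv> module_endo (ring_of_type_algebra :: 'k ring) A"

abbreviation D :: "nat \<Rightarrow> ('a \<Rightarrow> 'a) set" where
  "D \<equiv> diff_ops_le (ring_of_type_algebra :: 'k ring) A"

abbreviation M :: "nat \<Rightarrow> ('a, 'a \<Rightarrow> 'a) module" where
  "M i \<equiv> (diff_op_module (ring_of_type_algebra :: 'k ring) A)\<lparr>carrier := D i\<rparr>"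

definition op_zero :: "'a \<Rightarrow> 'a" where
  "op_zero = (\<lambda>x\<in>carrier A. \<zero>)"

definition op_add :: "('a \<Rightarrow> 'a) \<Rightarrow> ('a \<Rightarrow> 'a) \<Rightarrow> 'a \<Rightarrow> 'a" where
  "op_add u v = (\<lambda>x\<in>carrier A. u x \<oplus> v x)"

definition op_smult :: "'a \<Rightarrow> ('a \<Rightarrow> 'a) \<Rightarrow> 'a \<Rightarrow> 'a" where
  "op_smult a u = (\<lambda>x\<in>carrier A. a \<otimes> u x)"

text \<open>The commutator of multiplication by \<open>a\<close> with \<open>u\<close>, which
  governs the step from one order to the next.\<close>

definition op_comm :: "'a \<Rightarrow> ('a \<Rightarrow> 'a) \<Rightarrow> 'a \<Rightarrow> 'a" where
  "op_comm a u = (\<lambda>x\<in>carrier A. a \<otimes> u x \<ominus> u (a \<otimes> x))"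

lemma op_apply [simp]:
  assumes "x \<in> carrier A"
  shows "op_zero x = \<zero>" "op_add u v x = u x \<oplus> v x" "op_smult a u x = a \<otimes> u x"
    "op_comm a u x = a \<otimes> u x \<ominus> u (a \<otimes> x)"
  using assms by (simp_all add: op_zero_def op_add_def op_smult_def op_comm_def)

lemma op_extensional [simp]:
  "op_zero \<in> extensional (carrier A)" "op_add u v \<in> extensional (carrier A)"
  "op_smult a u \<in> extensional (carrier A)" "op_comm a u \<in> extensional (carrier A)"
  unfolding op_zero_def op_add_def op_smult_def op_comm_def by (rule restrict_extensional)+

lemma op_eqI:
  assumes "u \<in> extensional (carrier A)" "v \<in> extensional (carrier A)"
    "\<And>x. x \<in> carrier A \<Longrightarrow> u x = v x"
  shows "u = v"
  using assms by (rule extensionalityI)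

lemma phi_zero: "\<phi> 0 = \<zero>"
  using phi_add[of 0 0] by (metis add.r_cancel_one' add_0 phi_closed)

lemma endo_iff:
  "u \<in> endo \<longleftrightarrow> u \<in> carrier A \<rightarrow>\<^sub>E carrier A \<and>
    (\<forall>x\<in>carrier A. \<forall>y\<in>carrier A. u (x \<oplus> y) = u x \<oplus> u y) \<and>
    (\<forall>c. \<forall>x\<in>carrier A. u (\<phi> (mpoly_const c) \<otimes> x) = \<phi> (mpoly_const c) \<otimes> u x)"
  unfolding module_endo_def ring_of_type_algebra_def by (auto simp: smult_eq PiE_iff)

text \<open>Scalars act through elements of \<open>A\<close>, so A-linearity already implies
  K-linearity. Order zero thus takes the same shape as the higher orders.\<close>

lemma D_0_iff:
  "u \<in> D 0 \<longleftrightarrow> u \<in> endo \<and> (\<forall>a\<in>carrier A. \<forall>x\<in>carrier A. u (a \<otimes> x) = a \<otimes> u x)"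
  unfolding endo_iff by (auto simp: module_endo_def regular_module_def ring.defs module.defs)

lemma D_Suc_iff: "u \<in> D (Suc i) \<longleftrightarrow> u \<in> endo \<and> (\<forall>a\<in>carrier A. op_comm a u \<in> D i)"
  by (simp add: op_comm_def)

lemma D_endo: "u \<in> D i \<Longrightarrow> u \<in> endo"
  by (cases i) (auto simp: D_0_iff simp del: diff_ops_le.simps(1))

declare diff_ops_le.simps [simp del]

lemma D_extensional: "u \<in> D i \<Longrightarrow> u \<in> extensional (carrier A)"
  and D_closed: "u \<in> D i \<Longrightarrow> x \<in> carrier A \<Longrightarrow> u x \<in> carrier A"
  and D_additive: "u \<in> D i \<Longrightarrow> x \<in> carrier A \<Longrightarrow> y \<in> carrier A \<Longrightarrow> u (x \<oplus> y) = u x \<oplus> u y"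
  and D_const: "u \<in> D i \<Longrightarrow> x \<in> carrier A \<Longrightarrow>
    u (\<phi> (mpoly_const c) \<otimes> x) = \<phi> (mpoly_const c) \<otimes> u x"
  using D_endo[of u i] unfolding endo_iff by (auto simp: PiE_iff)

lemma op_zero_closed: "op_zero \<in> D i"
proof (induction i)
  case 0
  show ?case by (simp add: D_0_iff endo_iff PiE_iff)
next
  case (Suc i)
  have "op_comm a op_zero = op_zero" if "a \<in> carrier A" for a
    using that by (intro op_eqI) (simp_all add: minus_eq)
  then show ?case using Suc by (simp add: D_Suc_iff endo_iff PiE_iff)
qed

lemma op_add_closed: "u \<in> D i \<Longrightarrow> v \<in> D i \<Longrightarrow> op_add u v \<in> D i"
proof (induction i arbitrary: u v)
  case 0
  then show ?case by (auto simp: D_0_iff endo_iff PiE_iff r_distr add.m_ac)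
next
  case (Suc i)
  have "op_comm a (op_add u v) = op_add (op_comm a u) (op_comm a v)" if "a \<in> carrier A" for a
    using that D_closed[OF Suc.prems(1)] D_closed[OF Suc.prems(2)]
    by (intro op_eqI) (simp_all add: minus_eq r_distr minus_add add.m_ac)
  moreover have "op_add u v \<in> endo"
    using Suc.prems[THEN D_endo] by (auto simp: endo_iff PiE_iff r_distr add.m_ac)
  ultimately show ?case using Suc.IH Suc.prems by (simp add: D_Suc_iff)
qed

text \<open>Because \<open>A\<close> is commutative, [a, b u] = b [a, u], and the induction on the
  order goes through.\<close>

lemma op_smult_closed: "u \<in> D i \<Longrightarrow> b \<in> carrier A \<Longrightarrow> op_smult b u \<in> D i"
proof (induction i arbitrary: u)
  case 0
  then show ?case by (auto simp: D_0_iff endo_iff PiE_iff r_distr m_lcomm)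
next
  case (Suc i)
  have "op_comm a (op_smult b u) = op_smult b (op_comm a u)" if "a \<in> carrier A" for a
    using that D_closed[OF Suc.prems(1)] Suc.prems(2)
    by (intro op_eqI) (simp_all add: minus_eq r_distr r_minus m_ac)
  moreover have "op_smult b u \<in> endo"
    using Suc.prems(1)[THEN D_endo] Suc.prems(2) by (auto simp: endo_iff PiE_iff r_distr m_lcomm)
  ultimately show ?case using Suc.IH Suc.prems by (simp add: D_Suc_iff)
qed

lemma M_simps [simp]:
  "carrier (M i) = D i" "add (M i) = op_add" "ring.zero (M i) = op_zero" "module.smult (M i) = op_smult"
  by (simp_all add: diff_op_module_def op_zero_def op_add_def op_smult_def fun_eq_iff)

lemma module_M: "module A (M i)"
proof (rule moduleI)
  show "cring A" by (rule cring_axioms)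
  show "abelian_group (M i)"
  proof (rule abelian_groupI, simp_all only: M_simps)
    show "op_zero \<in> D i" by (rule op_zero_closed)
    fix u assume u: "u \<in> D i"
    note uc = D_closed[OF u]
    show "op_add op_zero u = u"
      using uc D_extensional[OF u] by (intro op_eqI) auto
    show "\<exists>v\<in>D i. op_add v u = op_zero"
    proof
      show "op_add (op_smult (\<ominus> \<one>) u) u = op_zero"
        using uc by (intro op_eqI) (simp_all add: l_minus l_neg)
    qed (use op_smult_closed[OF u] in simp)
    fix v assume v: "v \<in> D i"
    note vc = D_closed[OF v]
    show "op_add u v \<in> D i" using u v by (rule op_add_closed)
    show "op_add u v = op_add v u" using uc vc by (intro op_eqI) (simp_all add: a_comm)
    fix w assume w: "w \<in> D i"
    show "op_add (op_add u v) w = op_add u (op_add v w)"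
      using uc vc D_closed[OF w] by (intro op_eqI) (simp_all add: a_assoc)
  qed
next
  fix a u assume a: "a \<in> carrier A" and u: "u \<in> carrier (M i)"
  then have "u \<in> D i" by simp
  note uc = D_closed[OF this]
  show "a \<odot>\<^bsub>M i\<^esub> u \<in> carrier (M i)" using a u by (simp add: op_smult_closed)
  fix b assume b: "b \<in> carrier A"
  show "(a \<oplus> b) \<odot>\<^bsub>M i\<^esub> u = a \<odot>\<^bsub>M i\<^esub> u \<oplus>\<^bsub>M i\<^esub> b \<odot>\<^bsub>M i\<^esub> u"
    unfolding M_simps using a b uc by (intro op_eqI) (simp_all add: l_distr)
  show "(a \<otimes> b) \<odot>\<^bsub>M i\<^esub> u = a \<odot>\<^bsub>M i\<^esub> (b \<odot>\<^bsub>M i\<^esub> u)"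
    unfolding M_simps using a b uc by (intro op_eqI) (simp_all add: m_assoc)
next
  fix a u v assume a: "a \<in> carrier A" and "u \<in> carrier (M i)" "v \<in> carrier (M i)"
  then have "u \<in> D i" "v \<in> D i" by simp_all
  note uc = this[THEN D_closed]
  show "a \<odot>\<^bsub>M i\<^esub> (u \<oplus>\<^bsub>M i\<^esub> v) = a \<odot>\<^bsub>M i\<^esub> u \<oplus>\<^bsub>M i\<^esub> a \<odot>\<^bsub>M i\<^esub> v"
    unfolding M_simps using a uc by (intro op_eqI) (simp_all add: r_distr)
next
  fix u assume "u \<in> carrier (M i)"
  then have u: "u \<in> D i" by simp
  show "\<one> \<odot>\<^bsub>M i\<^esub> u = u"
    unfolding M_simps using D_closed[OF u] D_extensional[OF u] by (intro op_eqI) simp_all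
qed

section \<open>Determination of an operator by finitely many values\<close>

text \<open>The monomials of degree at most \<open>i\<close>. The products added at each stage are
  the arguments at which a commutator with a variable needs the values of \<open>u\<close>.\<close>

primrec eval_points :: "nat \<Rightarrow> ('n, 'k) mpoly set" where
  "eval_points 0 = {1}"
| "eval_points (Suc i) = eval_points i \<union>
    (\<Union>j. (*) (Poly_Mapping.single (Poly_Mapping.single j 1) 1) ` eval_points i)"

lemma finite_eval_points: "finite (eval_points i)"
  by (induction i) auto

lemma one_in_eval_points: "1 \<in> eval_points i"
  by (induction i) auto

lemma D_eq_zero:
  assumes "u \<in> D i" "\<And>f. f \<in> eval_points i \<Longrightarrow> u (\<phi> f) = \<zero>" "x \<in> carrier A"
  shows "u x = \<zero>"
  using assms
proof (induction i arbitrary: u x)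
  case 0
  have "u (x \<otimes> \<one>) = x \<otimes> u \<one>" using 0 unfolding D_0_iff by blast
  then show ?case using 0 phi_one by simp
next
  case (Suc i)
  note closed = D_closed[OF Suc.prems(1)]
  have X: "u (\<phi> (Poly_Mapping.single (Poly_Mapping.single j 1) 1) \<otimes> y)
      = \<phi> (Poly_Mapping.single (Poly_Mapping.single j 1) 1) \<otimes> u y" if y: "y \<in> carrier A" for j y
  proof -
    let ?X = "Poly_Mapping.single (Poly_Mapping.single j 1) 1 :: ('n, 'k) mpoly"
    have "op_comm (\<phi> ?X) u y = \<zero>"
    proof (rule Suc.IH[OF _ _ y])
      show "op_comm (\<phi> ?X) u \<in> D i" using Suc.prems(1) by (simp add: D_Suc_iff)
    next
      fix f assume f: "f \<in> eval_points i"
      \<comment> \<open>The commutator at \<open>f\<close> involves \<open>u\<close> at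
        \<open>f\<close> and at \<open>?X * f\<close>; both points have degree at most
        \<open>Suc i\<close>, where \<open>u\<close> vanishes by assumption.\<close>
      then have "f \<in> eval_points (Suc i)" "?X * f \<in> eval_points (Suc i)" by auto
      then show "op_comm (\<phi> ?X) u (\<phi> f) = \<zero>"
        using Suc.prems(2)[of f] Suc.prems(2)[of "?X * f"] by (simp add: phi_mult minus_eq)
    qed
    then show ?thesis using y closed by (simp add: r_right_minus_eq)
  qed
  have linear: "u (\<phi> f \<otimes> y) = \<phi> f \<otimes> u y" if "y \<in> carrier A" for f y
    using that
  proof (induction f arbitrary: y rule: mpoly_induct)
    case (const c)
    then show ?case using D_const[OF Suc.prems(1)] by blast
  next
    case (var j)
    then show ?case by (rule X)
  next
    case (add f g)
    then show ?case using closed by (simp add: phi_add l_distr D_additive[OF Suc.prems(1)])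
  next
    case (mult f g)
    then show ?case using closed by (simp add: phi_mult m_assoc)
  qed
  obtain s f where s: "\<phi> s \<in> Units A" "\<phi> s \<otimes> x = \<phi> f" using denominator Suc.prems(3) by blast
  \<comment> \<open>Linearity over polynomials passes to fractions: s x = f gives s u(x) = f u(1) =
    0, and the unit \<open>\<phi> s\<close> cancels.\<close>
  have "\<phi> s \<otimes> u x = u (\<phi> f \<otimes> \<one>)" using linear[of x s] s(2) Suc.prems(3) by simp
  also have "\<dots> = \<zero>"
    using linear[of \<one> f] Suc.prems(2)[OF one_in_eval_points] phi_one by simp
  also have "\<dots> = \<phi> s \<otimes> \<zero>" by simp
  finally show ?case using s(1) closed Suc.prems(3) by (simp only: Units_l_cancel zero_closed)
qed

text \<open>Apply \<open>D_eq_zero\<close> to the difference, formed as u + (-1) v so that closure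
  of \<open>D i\<close> applies. Evaluation thus embeds \<open>D i\<close> into a finite power of
  \<open>A\<close>.\<close>

lemma D_eqI:
  assumes u: "u \<in> D i" and v: "v \<in> D i"
    and eq: "\<And>f. f \<in> eval_points i \<Longrightarrow> u (\<phi> f) = v (\<phi> f)"
  shows "u = v"
proof (rule op_eqI[OF D_extensional[OF u] D_extensional[OF v]])
  fix x assume x: "x \<in> carrier A"
  let ?d = "op_add u (op_smult (\<ominus> \<one>) v)"
  have d: "?d y = u y \<ominus> v y" if "y \<in> carrier A" for y
    using that D_closed[OF v] by (simp add: l_minus minus_eq)
  have "?d x = \<zero>"
  proof (rule D_eq_zero[OF _ _ x])
    show "?d \<in> D i" using u v by (simp add: op_add_closed op_smult_closed)
    show "?d (\<phi> f) = \<zero>" if "f \<in> eval_points i" for f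
      using d[of "\<phi> f"] eq[OF that] D_closed[OF v] by (simp add: minus_eq r_neg)
  qed
  then show "u x = v x" using d x D_closed[OF u] D_closed[OF v] by (simp add: r_right_minus_eq)
qed

lemma common_denominator:
  assumes "finite J" "\<And>j. j \<in> J \<Longrightarrow> m j \<in> carrier A"
  shows "\<exists>s. \<phi> s \<in> Units A \<and> (\<forall>j\<in>J. \<exists>f. \<phi> s \<otimes> m j = \<phi> f)"
  using assms
proof (induction J rule: finite_induct)
  case empty
  show ?case by (rule exI[of _ 1]) (simp add: phi_one)
next
  case (insert j J)
  obtain s where s: "\<phi> s \<in> Units A" "\<And>i. i \<in> J \<Longrightarrow> \<exists>f. \<phi> s \<otimes> m i = \<phi> f" using insert by auto
  obtain t g where t: "\<phi> t \<in> Units A" "\<phi> t \<otimes> m j = \<phi> g" using denominator insert.prems by blast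
  have "\<exists>f. \<phi> (s * t) \<otimes> m i = \<phi> f" if i: "i \<in> insert j J" for i
  proof (cases "i = j")
    case True
    then have "\<phi> (s * t) \<otimes> m i = \<phi> (s * g)"
      using insert.prems by (simp add: phi_mult m_assoc t(2))
    then show ?thesis ..
  next
    case False
    then obtain f where f: "\<phi> s \<otimes> m i = \<phi> f" using s(2) i by blast
    have "\<phi> (s * t) \<otimes> m i = \<phi> t \<otimes> (\<phi> s \<otimes> m i)"
      using insert.prems i by (simp add: phi_mult m_ac)
    then have "\<phi> (s * t) \<otimes> m i = \<phi> (t * f)" by (simp add: phi_mult f)
    then show ?thesis ..
  qed
  then show ?case using s(1) t(1) by (intro exI[of _ "s * t"]) (auto simp: phi_mult)
qed

section \<open>Finite generation of each filtration step\<close>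

theorem finitely_generated_M: "finitely_generated_module A (M i)"
proof -
  interpret M: module A "M i" by (rule module_M)
  let ?J = "eval_points i"
  \<comment> \<open>\<open>v\<close> is a polynomial lift of the vector of values of
    \<open>u\<close>. The lift need not be unique, but by \<open>D_eqI\<close> it determines
    \<open>u\<close> within \<open>D i\<close>.\<close>
  define rep where "rep u v \<longleftrightarrow> (\<forall>f\<in>?J. u (\<phi> f) = \<phi> (v f))"
    for u :: "'a \<Rightarrow> 'a" and v :: "('n, 'k) mpoly \<Rightarrow> ('n, 'k) mpoly"
  have rep_zero: "rep op_zero 0" by (simp add: rep_def phi_zero)
  have rep_add: "rep (op_add u u') (v + v')" if "rep u v" "rep u' v'" for u u' v v'
    using that by (simp add: rep_def phi_add)
  have rep_smult: "rep (op_smult (\<phi> c) u) (\<lambda>f. c * v f)" if "rep u v" for c u v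
    using that by (simp add: rep_def phi_mult)
  \<comment> \<open>The preimage of the embedded \<open>D i\<close> in a finite power of P_n;
    requiring zero off \<open>?J\<close> makes the function space such a power.\<close>
  define W where "W = {v. (\<forall>f. f \<notin> ?J \<longrightarrow> v f = 0) \<and> (\<exists>u\<in>D i. rep u v)}"
  have W: "fun_module.subspace W"
  proof (rule fun_module.subspaceI)
    show "0 \<in> W" unfolding W_def using rep_zero op_zero_closed by auto
    show "v + w \<in> W" if "v \<in> W" "w \<in> W" for v w
      using that rep_add op_add_closed unfolding W_def by (simp, blast)
    show "(\<lambda>f. c * v f) \<in> W" if "v \<in> W" for c v
      using that rep_smult[of _ v c] op_smult_closed[OF _ phi_closed[of c]] unfolding W_def by (simp, blast)
  qed
  have "v f = 0" if "v \<in> W" "f \<notin> ?J" for v f using that unfolding W_def by simp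
  with submodule_fun_finitely_generated[OF finite_eval_points[of i] W]
  obtain G where G: "finite G" "W = fun_module.span G" by metis
  have "\<forall>g\<in>G. \<exists>u. u \<in> D i \<and> rep u g"
    using G(2) fun_module.span_superset[of G] unfolding W_def by blast
  then obtain U where U: "\<And>g. g \<in> G \<Longrightarrow> U g \<in> D i" "\<And>g. g \<in> G \<Longrightarrow> rep (U g) g" by metis
  let ?F = "U ` G"
  have F: "finite ?F" "?F \<subseteq> carrier (M i)" using G(1) U(1) by auto
  have comb_D: "x \<in> D i" if "x \<in> M.combinations ?F" for x
    using that M.combinations_closed[OF F(2)] by auto
  \<comment> \<open>Since \<open>rep\<close> respects sums and multiplication by polynomials, a
    polynomial combination of \<open>G\<close> lifts the values of the corresponding combination of
    the operators \<open>U g\<close>.\<close>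
  have span: "\<exists>w\<in>M.combinations ?F. rep w v" if "v \<in> fun_module.span G" for v
    using that
  proof (induction rule: fun_module.span_induct_alt)
    case base
    have "op_zero \<in> M.combinations ?F" using M.combinations_zero[OF F(2)] by simp
    with rep_zero show ?case by (rule bexI)
  next
    case (step c x y)
    then obtain w where w: "w \<in> M.combinations ?F" "rep w y" by blast
    have "U x \<in> M.combinations ?F" using step(1) by (intro M.combinations_base F) simp
    then have "op_smult (\<phi> c) (U x) \<in> M.combinations ?F"
      using M.combinations_smult[OF F _ phi_closed] by simp
    then have "op_add (op_smult (\<phi> c) (U x)) w \<in> M.combinations ?F"
      using M.combinations_add[OF F(2) _ w(1)] by simp
    moreover have "rep (op_add (op_smult (\<phi> c) (U x)) w) ((\<lambda>f. c * x f) + y)"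
      using U(2)[OF step(1)] w(2) by (intro rep_add rep_smult)
    ultimately show ?case by blast
  qed
  have "m \<in> M.combinations ?F" if m: "m \<in> D i" for m
  proof -
    obtain s where s: "\<phi> s \<in> Units A" "\<forall>f\<in>?J. \<exists>g. \<phi> s \<otimes> m (\<phi> f) = \<phi> g"
      using common_denominator[OF finite_eval_points, of i "\<lambda>f. m (\<phi> f)"] D_closed[OF m] by auto
    then obtain v where v: "\<And>f. f \<in> ?J \<Longrightarrow> \<phi> s \<otimes> m (\<phi> f) = \<phi> (v f)" by metis
    \<comment> \<open>Extension by zero off the evaluation points is what membership in
      \<open>W\<close> demands.\<close>
    define v' where "v' f = (if f \<in> ?J then v f else 0)" for f
    let ?m = "op_smult (\<phi> s) m"
    have "rep ?m v'" unfolding rep_def v'_def using v by simp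
    moreover have "?m \<in> D i" using m by (simp add: op_smult_closed)
    ultimately have "v' \<in> fun_module.span G" unfolding G(2)[symmetric] W_def v'_def by auto
    then obtain w where w: "w \<in> M.combinations ?F" "rep w v'" using span by blast
    \<comment> \<open>Both operators have \<open>v'\<close> as a lift of their values, so they agree
      at all evaluation points. Dividing by the unit \<open>\<phi> s\<close> then recovers
      \<open>m\<close>.\<close>
    have "?m = w"
      using \<open>?m \<in> D i\<close> comb_D[OF w(1)] \<open>rep ?m v'\<close> w(2) unfolding rep_def by (intro D_eqI) auto
    then have "op_smult (inv (\<phi> s)) ?m \<in> M.combinations ?F"
      using M.combinations_smult[OF F w(1), of "inv (\<phi> s)"] s(1) by simp
    moreover have "op_smult (inv (\<phi> s)) ?m = m"
      using s(1) D_closed[OF m] D_extensional[OF m]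
      by (intro op_eqI) (auto simp flip: m_assoc)
    ultimately show ?thesis by simp
  qed
  then have "\<exists>c\<in>?F \<rightarrow> carrier A. m = (\<Oplus>\<^bsub>M i\<^esub>f\<in>?F. c f \<odot>\<^bsub>M i\<^esub> f)" if "m \<in> carrier (M i)" for m
    using that unfolding M.combinations_def M_simps(1) by blast
  then show ?thesis
    unfolding finitely_generated_module_def
    by (intro conjI exI[of _ ?F] ballI module_M F)
qed

end

section \<open>The localized quotient as an instance\<close>

lemma loc_algebra_simps:
  fixes I :: "('n::finite, 'k::field) mpoly set"
  shows "carrier (loc_algebra I S) = carrier (localization (mpoly_ring Quot I) S)"
    "monoid.mult (loc_algebra I S) = monoid.mult (localization (mpoly_ring Quot I) S)"
    "one (loc_algebra I S) = one (localization (mpoly_ring Quot I) S)"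
    "add (loc_algebra I S) = add (localization (mpoly_ring Quot I) S)"
    "c \<odot>\<^bsub>loc_algebra I S\<^esub> x = loc_frac (mpoly_ring Quot I) S (I +>\<^bsub>mpoly_ring\<^esub> mpoly_const c)
      \<one>\<^bsub>mpoly_ring Quot I\<^esub> \<otimes>\<^bsub>localization (mpoly_ring Quot I) S\<^esub> x"
  by (simp_all add: loc_algebra_def Let_def ring.defs module.defs)

text \<open>A fraction a/s is treated by lifting \<open>a\<close> and \<open>s\<close> to
  polynomials \<open>f\<close> and \<open>g\<close>: the image of \<open>g\<close> is s/1, with
  inverse 1/s, and it clears the denominator. The commutative ring axioms are a premise because
  \<open>domain A\<close> supplies them in the final theorem.\<close>

lemma localized_mpoly_algebra_loc_algebra:
  fixes I :: "('n::finite, 'k::field) mpoly set"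
  assumes I: "ideal I mpoly_ring" and S: "submonoid S (mpoly_ring Quot I)"
    and A: "cring (loc_algebra I S)"
  shows "localized_mpoly_algebra (loc_algebra I S)
    (\<lambda>f. loc_frac (mpoly_ring Quot I) S (I +>\<^bsub>mpoly_ring\<^esub> f) \<one>\<^bsub>mpoly_ring Quot I\<^esub>)"
proof -
  let ?P = "mpoly_ring :: ('n, 'k) mpoly ring"
  define Q where "Q = ?P Quot I"
  define L where "L = localization Q S"
  define \<phi> where "\<phi> f = loc_frac Q S (I +>\<^bsub>?P\<^esub> f) \<one>\<^bsub>Q\<^esub>" for f
  note A_simps = loc_algebra_simps[of I S, folded Q_def, folded L_def, folded \<phi>_def]
  note S = S[folded Q_def]
  interpret A: cring "loc_algebra I S" by (rule A)
  interpret Q: cring Q unfolding Q_def using I by (rule ideal.quotient_is_cring) auto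
  have P_simps: "carrier ?P = UNIV" "f \<otimes>\<^bsub>?P\<^esub> g = f * g" "f \<oplus>\<^bsub>?P\<^esub> g = f + g" "\<one>\<^bsub>?P\<^esub> = 1" for f g
    by (simp_all add: ring_of_type_algebra_def)
  have hom: "\<phi> \<in> ring_hom ?P L"
    using ring_hom_trans[OF ideal.rcos_ring_hom[OF I, folded Q_def] Q.loc_frac_hom[OF S]]
    by (simp add: \<phi>_def[abs_def] L_def comp_def)
  have coset: "\<exists>f. a = I +>\<^bsub>?P\<^esub> f" if "a \<in> carrier Q" for a
    using that by (auto simp: Q_def FactRing_def A_RCOSETS_def' P_simps a_r_coset_def)
  have "localized_mpoly_algebra (loc_algebra I S) \<phi>"
  proof (unfold_locales)
    show "\<phi> f \<in> carrier (loc_algebra I S)" for f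
      using ring_hom_closed[OF hom, of f] by (simp add: A_simps P_simps)
    show "\<phi> (f + g) = \<phi> f \<oplus>\<^bsub>loc_algebra I S\<^esub> \<phi> g" for f g
      using ring_hom_add[OF hom, of f g] by (simp add: A_simps P_simps)
    show "\<phi> (f * g) = \<phi> f \<otimes>\<^bsub>loc_algebra I S\<^esub> \<phi> g" for f g
      using ring_hom_mult[OF hom, of f g] by (simp add: A_simps P_simps)
    show "\<phi> 1 = \<one>\<^bsub>loc_algebra I S\<^esub>"
      using ring_hom_one[OF hom] by (simp add: A_simps P_simps)
    show "c \<odot>\<^bsub>loc_algebra I S\<^esub> x = \<phi> (mpoly_const c) \<otimes>\<^bsub>loc_algebra I S\<^esub> x" for c x
      by (simp add: A_simps)
  next
    fix x assume "x \<in> carrier (loc_algebra I S)"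
    then obtain a s where x: "x = loc_frac Q S a s" and a: "a \<in> carrier Q" and s: "s \<in> S"
      unfolding A_simps L_def Q.carrier_localization by blast
    have s': "s \<in> carrier Q" using submonoid.subset[OF S] s by blast
    note one = submonoid.one_closed[OF S]
    obtain f where f: "a = I +>\<^bsub>?P\<^esub> f" using coset[OF a] ..
    obtain g where g: "s = I +>\<^bsub>?P\<^esub> g" using coset[OF s'] ..
    have phi: "\<phi> f = loc_frac Q S a \<one>\<^bsub>Q\<^esub>" "\<phi> g = loc_frac Q S s \<one>\<^bsub>Q\<^esub>"
      by (simp_all add: \<phi>_def f g)
    have carr: "\<phi> h \<in> carrier L" for h using ring_hom_closed[OF hom, of h] by (simp add: P_simps)
    have inv_carr: "loc_frac Q S \<one>\<^bsub>Q\<^esub> s \<in> carrier L"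
      using s unfolding L_def Q.carrier_localization by blast
    have unit: "\<phi> g \<otimes>\<^bsub>L\<^esub> loc_frac Q S \<one>\<^bsub>Q\<^esub> s = \<one>\<^bsub>L\<^esub>"
      unfolding phi L_def using s s' one Q.loc_frac_self[OF S s]
      by (simp add: Q.localization_mult[OF S])
    then have "\<phi> g \<in> Units (loc_algebra I S)"
      using carr[of g] inv_carr A.m_comm[of "\<phi> g" "loc_frac Q S \<one>\<^bsub>Q\<^esub> s"]
      unfolding Units_def A_simps by auto
    \<comment> \<open>The product (s/1)(a/s) is rearranged as (a/1)(s/s), whose second factor is
      one.\<close>
    moreover have "\<phi> g \<otimes>\<^bsub>L\<^esub> x = \<phi> f \<otimes>\<^bsub>L\<^esub> loc_frac Q S s s"
      unfolding phi x L_def using a s s' one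
      by (simp add: Q.localization_mult[OF S] Q.m_comm)
    then have "\<phi> g \<otimes>\<^bsub>L\<^esub> x = \<phi> f"
      unfolding Q.loc_frac_self[OF S s] L_def[symmetric]
      using A.r_one[of "\<phi> f"] carr[of f] unfolding A_simps by simp
    ultimately show "\<exists>s f. \<phi> s \<in> Units (loc_algebra I S) \<and> \<phi> s \<otimes>\<^bsub>loc_algebra I S\<^esub> x = \<phi> f"
      unfolding A_simps by blast
  qed
  then show ?thesis unfolding \<phi>_def Q_def .
qed

theorem theorem1p6:
  fixes I :: "('n::finite, 'k::field) mpoly set"
    and S :: "('n, 'k) mpoly set set"
    and A :: "('k, (('n, 'k) mpoly set \<times> ('n, 'k) mpoly set) set) module"
    and K :: "'k ring"
    and p i :: nat
  assumes "perfect_field TYPE('k)"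
    and "CHAR('k) = p" and "p > 0"
    and "primeideal I mpoly_ring" and "\<not> maximalideal I mpoly_ring"
    and "submonoid S (mpoly_ring Quot I)"
    and "K = ring_of_type_algebra"
    and "A = loc_algebra I S"
    and "domain A"
  shows "finitely_generated_module A ((diff_op_module K A)\<lparr>carrier := diff_ops_le K A i\<rparr>)"
proof -
  have "cring A" using \<open>domain A\<close> by (rule domain.axioms(1))
  then interpret localized_mpoly_algebra A
    "\<lambda>f. loc_frac (mpoly_ring Quot I) S (I +>\<^bsub>mpoly_ring\<^esub> f) \<one>\<^bsub>mpoly_ring Quot I\<^esub>"
    using assms(6) primeideal.axioms(1)[OF assms(4)]
    unfolding \<open>A = loc_algebra I S\<close> by (intro localized_mpoly_algebra_loc_algebra)
  show ?thesis unfolding \<open>K = ring_of_type_algebra\<close> by (rule finitely_generated_M)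
qed

end
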